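(* There is an absolute constant $C>0$ such that for all integers $n, t \geq 1$, $\lambda(n, C_{2t+1}) \leq C\, t\, n^{1/(2t+1)}$.
   Context: An orthonormal representation of a graph $G$ is a map $f: V(G) \to \mathbb{R}^d$ (some $d$) with $\|f(u)\|=1$ for all $u$ and $\langle f(u), f(v)\rangle = 0$ for all distinct non-adjacent $u,v$. For a graph $G$, $\vartheta(\overline{G})$ (the Lovász theta function of the complement of $G$) equals the maximum, over all orthonormal representations $f$ of $G$, of the largest eigenvalue of the Gram matrix $(\langle f(u), f(v)\rangle)_{u,v}$. A graph is $H$-free if it contains no (not necessarily induced) subgraph isomorphic to $H$. $\lambda(n,H)$ denotes the maximum of $\vartheta(\overline{G})$ over all $H$-free simple graphs $G$ on $n$ vertices. $C_k$ is the cycle of length $k$. *)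

theory Defs
  imports
    Complex_Main
    "Graph_Theory.Graph_Theory"
    "Jordan_Normal_Form.Spectral_Radius"
begin

section \<open>Forbidden subgraphs\<close>

text \<open>
  Finite simple graphs are the structures satisfying \<^locale>\<open>pair_graph\<close>: an edge between
  \<open>u\<close> and \<open>v\<close> is the pair of arcs \<open>(u,v)\<close>, \<open>(v,u)\<close>, and there are no loops.
  The subgraph \<open>K\<close> below ranges over subdigraphs, but for symmetric \<open>H\<close> any \<open>K\<close> isomorphic
  to \<open>H\<close> is itself symmetric.
\<close>

definition H_free :: "'b pair_pre_digraph \<Rightarrow> 'a pair_pre_digraph \<Rightarrow> bool" where
  "H_free H G \<longleftrightarrow> \<not> (\<exists>K. subgraph K (with_proj G) \<and> digraph_iso K (with_proj H))"

text \<open>This is the \<open>k\<close>-cycle only for \<open>k \<ge> 3\<close>; smaller \<open>k\<close> give degenerate graphs.\<close>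

definition cycle_graph :: "nat \<Rightarrow> nat pair_pre_digraph" where
  "cycle_graph k =
     \<lparr>pverts = {..<k},
      parcs = {(i, j). i < k \<and> j < k \<and> (j = Suc i mod k \<or> i = Suc j mod k)}\<rparr>"

section \<open>Orthonormal representations and the theta function\<close>

definition orthonormal_rep :: "'a pair_pre_digraph \<Rightarrow> nat \<Rightarrow> ('a \<Rightarrow> real vec) \<Rightarrow> bool" where
  "orthonormal_rep G d f \<longleftrightarrow>
     (\<forall>u \<in> pverts G. f u \<in> carrier_vec d \<and> sqrt (f u \<bullet> f u) = 1) \<and>
     (\<forall>u \<in> pverts G. \<forall>v \<in> pverts G. u \<noteq> v \<and> \<not> u \<rightarrow>\<^bsub>with_proj G\<^esub> v \<longrightarrow> f u \<bullet> f v = 0)"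

definition gram_mat :: "nat \<Rightarrow> (nat \<Rightarrow> real vec) \<Rightarrow> real mat" where
  "gram_mat n f = mat n n (\<lambda>(u, v). f u \<bullet> f v)"

definition largest_eigenvalue :: "real mat \<Rightarrow> real" where
  "largest_eigenvalue A = Max (spectrum A)"

text \<open>
  \<open>theta_bar G\<close> is the theta function of the complement of \<open>G\<close>, in its characterisation as
  the maximum of the largest eigenvalue of the Gram matrix over all orthonormal
  representations of \<open>G\<close>, in any dimension. It is only meaningful for graphs with vertex set
  \<open>{..<n}\<close>, \<open>n \<ge> 1\<close>, so that vertices can serve as matrix indices. The set of values is nonempty
  and bounded (see below), and by compactness its supremum is attained.
\<close>

definition theta_bar :: "nat pair_pre_digraph \<Rightarrow> real" where
  "theta_bar G =
     Sup {largest_eigenvalue (gram_mat (card (pverts G)) f) | d f. orthonormal_rep G d f}"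

text \<open>
  Every graph on \<open>n\<close> vertices has an isomorphic copy with vertex set \<open>{..<n}\<close>, so the maximum
  is over finitely many graphs.
\<close>

definition lambda_free :: "nat \<Rightarrow> 'b pair_pre_digraph \<Rightarrow> real" where
  "lambda_free n H =
     Max {theta_bar G | G. pair_graph G \<and> pverts G = {..<n} \<and> H_free H G}"

section \<open>The suprema and maxima are well-defined\<close>

lemma pair_graph_cycle_graph:
  assumes "k \<ge> 3"
  shows "pair_graph (cycle_graph k)"
proof -
  have fin: "finite (parcs (cycle_graph k))"
    by (rule finite_subset[of _ "{..<k} \<times> {..<k}"]) (auto simp: cycle_graph_def)
  have noloop: "Suc i mod k \<noteq> i" if "i < k" for i
    using that assms by (auto simp: mod_Suc)
  show ?thesis
  proof (unfold_locales, goal_cases)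
    case (5 e)
    obtain i j where "e = (i, j)" by (cases e)
    with 5 show ?case using noloop[of i] by (auto simp: cycle_graph_def)
  qed (use fin in \<open>auto simp: cycle_graph_def symmetric_def sym_def\<close>)
qed

lemma gram_mat_carrier: "gram_mat n f \<in> carrier_mat n n"
  by (simp add: gram_mat_def)

lemma real_symmetric_spectrum_nonempty:
  fixes A :: "real mat"
  assumes A: "A \<in> carrier_mat n n" and n: "n > 0"
    and sym: "\<And>i j. i < n \<Longrightarrow> j < n \<Longrightarrow> A $$ (i, j) = A $$ (j, i)"
  shows "spectrum A \<noteq> {}"
proof -
  define B where "B = map_mat complex_of_real A"
  have B: "B \<in> carrier_mat n n" using A by (simp add: B_def)
  from spectrum_non_empty[OF B n] obtain k where k: "eigenvalue B k"
    unfolding spectrum_def by auto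
  then obtain v where v: "v \<in> carrier_vec n" "v \<noteq> 0\<^sub>v n" "B *\<^sub>v v = k \<cdot>\<^sub>v v"
    using B unfolding eigenvalue_def eigenvector_def by auto
  have row: "(\<Sum>j<n. of_real (A $$ (i, j)) * v $ j) = k * v $ i" if "i < n" for i
  proof -
    have "(B *\<^sub>v v) $ i = (\<Sum>j<n. of_real (A $$ (i, j)) * v $ j)"
      using that A v(1) by (simp add: B_def scalar_prod_def atLeast0LessThan)
    then show ?thesis using v that by simp
  qed
  define s where "s = (\<Sum>i<n. (cmod (v $ i))\<^sup>2)"
  define q where "q = (\<Sum>i<n. \<Sum>j<n. cnj (v $ i) * of_real (A $$ (i, j)) * v $ j)"
  have "s \<noteq> 0"
  proof
    assume "s = 0"
    then have "\<And>i. i < n \<Longrightarrow> v $ i = 0"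
      by (subst (asm) s_def, subst (asm) sum_nonneg_eq_0_iff) auto
    then have "v = 0\<^sub>v n" using v(1) by (intro eq_vecI) auto
    with v(2) show False by simp
  qed
  have "q = (\<Sum>i<n. cnj (v $ i) * (k * v $ i))"
    unfolding q_def
    by (rule sum.cong) (auto simp: row[symmetric] sum_distrib_left mult.assoc)
  also have "\<dots> = (\<Sum>i<n. k * of_real ((cmod (v $ i))\<^sup>2))"
    by (rule sum.cong, simp, unfold complex_norm_square, simp add: algebra_simps)
  also have "\<dots> = k * of_real s"
    unfolding s_def by (simp add: sum_distrib_left)
  finally have qk: "q = k * of_real s" .
  have "cnj q = (\<Sum>i<n. \<Sum>j<n. cnj (v $ j) * of_real (A $$ (i, j)) * v $ i)"
    by (simp add: q_def mult.commute mult.left_commute)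
  also have "\<dots> = (\<Sum>j<n. \<Sum>i<n. cnj (v $ j) * of_real (A $$ (i, j)) * v $ i)"
    by (rule sum.swap)
  also have "\<dots> = q"
    unfolding q_def by (intro sum.cong refl) (simp add: sym)
  finally have "cnj k * of_real s = k * of_real s" using qk by simp
  then have "cnj k = k" using \<open>s \<noteq> 0\<close> by simp
  then obtain r where r: "k = complex_of_real r" by (metis Reals_cnj_iff Reals_cases)
  have "poly (char_poly B) k = 0"
    using k eigenvalue_root_char_poly[OF B] by simp
  moreover have "char_poly B = map_poly complex_of_real (char_poly A)"
    unfolding B_def by (rule of_real_hom.char_poly_hom[OF A])
  ultimately have "poly (char_poly A) r = 0"
    by (simp add: r of_real_hom.poly_map_poly)
  then have "eigenvalue A r" using eigenvalue_root_char_poly[OF A] by simp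
  then show ?thesis by (auto simp: spectrum_def)
qed

lemma largest_eigenvalue_in_spectrum:
  assumes "pair_graph G" "pverts G = {..<n}" "n > 0" "orthonormal_rep G d f"
  shows "largest_eigenvalue (gram_mat n f) \<in> spectrum (gram_mat n f)"
proof -
  have "gram_mat n f $$ (i, j) = gram_mat n f $$ (j, i)" if "i < n" "j < n" for i j
    using assms that comm_scalar_prod[of "f i" d "f j"]
    by (auto simp: gram_mat_def orthonormal_rep_def)
  from real_symmetric_spectrum_nonempty[OF gram_mat_carrier assms(3) this]
  show ?thesis
    unfolding largest_eigenvalue_def
    using card_finite_spectrum(1)[OF gram_mat_carrier] by (intro Max_in)
qed

lemma abs_scalar_prod_unit_le:
  fixes x y :: "real vec"
  assumes "x \<in> carrier_vec d" "y \<in> carrier_vec d" "x \<bullet> x = 1" "y \<bullet> y = 1"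
  shows "\<bar>x \<bullet> y\<bar> \<le> 1"
proof -
  have xx: "(\<Sum>i<d. (x $ i)\<^sup>2) = 1" and yy: "(\<Sum>i<d. (y $ i)\<^sup>2) = 1"
    using assms by (auto simp: scalar_prod_def atLeast0LessThan power2_eq_square)
  have "\<bar>x \<bullet> y\<bar> = \<bar>\<Sum>i<d. x $ i * y $ i\<bar>"
    using assms by (simp add: scalar_prod_def atLeast0LessThan)
  also have "\<dots> \<le> (\<Sum>i<d. \<bar>x $ i * y $ i\<bar>)" by (rule sum_abs)
  also have "\<dots> \<le> (\<Sum>i<d. ((x $ i)\<^sup>2 + (y $ i)\<^sup>2) / 2)"
  proof (rule sum_mono)
    fix i
    have "0 \<le> (\<bar>x $ i\<bar> - \<bar>y $ i\<bar>)\<^sup>2" by simp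
    then show "\<bar>x $ i * y $ i\<bar> \<le> ((x $ i)\<^sup>2 + (y $ i)\<^sup>2) / 2"
      by (simp add: power2_diff abs_mult)
  qed
  also have "\<dots> = 1"
    unfolding sum_divide_distrib[symmetric] sum.distrib xx yy by simp
  finally show ?thesis .
qed

lemma eigenvalue_gram_mat_le:
  assumes G: "pverts G = {..<n}" and rep: "orthonormal_rep G d f"
    and ev: "eigenvalue (gram_mat n f) k"
  shows "k \<le> real n"
proof -
  from ev obtain v where v: "v \<in> carrier_vec n" "v \<noteq> 0\<^sub>v n" "gram_mat n f *\<^sub>v v = k \<cdot>\<^sub>v v"
    unfolding eigenvalue_def eigenvector_def by (auto simp: gram_mat_def)
  then have ne: "n > 0" by (cases n) auto
  define M where "M = Max ((\<lambda>i. \<bar>v $ i\<bar>) ` {..<n})"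
  have fin: "finite ((\<lambda>i. \<bar>v $ i\<bar>) ` {..<n})" by simp
  have le: "\<bar>v $ i\<bar> \<le> M" if "i < n" for i
    unfolding M_def using that by (intro Max_ge[OF fin]) auto
  have "M \<in> (\<lambda>i. \<bar>v $ i\<bar>) ` {..<n}"
    unfolding M_def using ne by (intro Max_in[OF fin]) auto
  then obtain i where i: "i < n" "\<bar>v $ i\<bar> = M" by auto
  have "M > 0"
  proof (rule ccontr)
    assume "\<not> M > 0"
    then have "\<And>j. j < n \<Longrightarrow> v $ j = 0" using le by (smt (verit) abs_ge_zero)
    then have "v = 0\<^sub>v n" using v(1) by (intro eq_vecI) auto
    with v(2) show False by simp
  qed
  have "k * v $ i = (gram_mat n f *\<^sub>v v) $ i" using v i by simp
  also have "\<dots> = vec n (\<lambda>j. f i \<bullet> f j) \<bullet> v"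
    using i by (simp add: gram_mat_def)
  also have "\<dots> = (\<Sum>j<n. (f i \<bullet> f j) * v $ j)"
    unfolding scalar_prod_def[of _ v] using v(1)
    by (auto simp: atLeast0LessThan intro!: sum.cong)
  finally have "\<bar>k\<bar> * M = \<bar>\<Sum>j<n. (f i \<bullet> f j) * v $ j\<bar>" using i by (metis abs_mult)
  also have "\<dots> \<le> (\<Sum>j<n. \<bar>(f i \<bullet> f j) * v $ j\<bar>)" by (rule sum_abs)
  also have "\<dots> \<le> (\<Sum>j<n. 1 * M)"
  proof (rule sum_mono)
    fix j assume "j \<in> {..<n}"
    then have "\<bar>f i \<bullet> f j\<bar> \<le> 1" "\<bar>v $ j\<bar> \<le> M"
      using le rep i G unfolding orthonormal_rep_def
      by (auto intro!: abs_scalar_prod_unit_le)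
    then show "\<bar>(f i \<bullet> f j) * v $ j\<bar> \<le> 1 * M"
      unfolding abs_mult by (intro mult_mono) auto
  qed
  also have "\<dots> = real n * M" by simp
  finally have "\<bar>k\<bar> \<le> real n" using \<open>M > 0\<close> by simp
  then show ?thesis by simp
qed

lemma theta_bar_bdd_above:
  assumes "pair_graph G" "pverts G = {..<n}" "n > 0"
  shows "bdd_above {largest_eigenvalue (gram_mat (card (pverts G)) f) | d f. orthonormal_rep G d f}"
proof (rule bdd_aboveI[of _ "real n"])
  fix x assume "x \<in> {largest_eigenvalue (gram_mat (card (pverts G)) f) | d f. orthonormal_rep G d f}"
  then obtain d f where x: "x = largest_eigenvalue (gram_mat n f)" and f: "orthonormal_rep G d f"
    using assms by auto
  from largest_eigenvalue_in_spectrum[OF assms f]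
  show "x \<le> real n"
    unfolding x spectrum_def using eigenvalue_gram_mat_le[OF assms(2) f] by simp
qed

lemma theta_bar_nonempty:
  assumes "pverts G = {..<n}"
  shows "{largest_eigenvalue (gram_mat (card (pverts G)) f) | d f. orthonormal_rep G d f} \<noteq> {}"
proof -
  have "orthonormal_rep G n (unit_vec n)"
    using assms by (auto simp: orthonormal_rep_def)
  then show ?thesis by blast
qed

lemma lambda_free_finite:
  "finite {theta_bar G | G. pair_graph G \<and> pverts G = {..<n} \<and> H_free H G}"
proof -
  have "{G :: nat pair_pre_digraph. pair_graph G \<and> pverts G = {..<n} \<and> H_free H G}
      \<subseteq> (\<lambda>E. \<lparr>pverts = {..<n}, parcs = E\<rparr>) ` Pow ({..<n} \<times> {..<n})"
  proof
    fix G :: "nat pair_pre_digraph"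
    assume "G \<in> {G. pair_graph G \<and> pverts G = {..<n} \<and> H_free H G}"
    then have G: "pair_graph G" "pverts G = {..<n}" by auto
    interpret pair_graph G by (rule G(1))
    have "parcs G \<subseteq> {..<n} \<times> {..<n}"
      using G(2) by (auto dest: in_arcsD1 in_arcsD2)
    moreover have "G = \<lparr>pverts = {..<n}, parcs = parcs G\<rparr>" using G(2) by (cases G) simp
    ultimately show "G \<in> (\<lambda>E. \<lparr>pverts = {..<n}, parcs = E\<rparr>) ` Pow ({..<n} \<times> {..<n})"
      by blast
  qed
  then have "finite {G :: nat pair_pre_digraph. pair_graph G \<and> pverts G = {..<n} \<and> H_free H G}"
    by (rule finite_subset) simp
  then show ?thesis
    by (rule finite_image_set)
qed

lemma lambda_free_cycle_nonempty:
  assumes "k \<ge> 3"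
  shows "{theta_bar G | G. pair_graph G \<and> pverts G = {..<n} \<and> H_free (cycle_graph k) G} \<noteq> {}"
proof -
  let ?G = "\<lparr>pverts = {..<n}, parcs = {}\<rparr> :: nat pair_pre_digraph"
  have "pair_graph ?G" by unfold_locales (auto simp: symmetric_def)
  moreover have "H_free (cycle_graph k) ?G"
  proof (unfold H_free_def, rule notI, elim exE conjE)
    fix K assume K: "subgraph K (with_proj ?G)" "digraph_iso K (with_proj (cycle_graph k))"
    then obtain h where "with_proj (cycle_graph k) = app_iso h K"
      unfolding digraph_iso_def by blast
    then have "parcs (cycle_graph k) = iso_arcs h ` arcs K"
      by (metis arcs_app_iso with_proj_simps(2))
    moreover have "arcs K = {}" using K(1) by (auto simp: subgraph_def)
    moreover have "(0, 1) \<in> parcs (cycle_graph k)" using assms by (auto simp: cycle_graph_def)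
    ultimately show False by simp
  qed
  ultimately show ?thesis by (auto intro!: exI[of _ ?G])
qed

end

theory Submission
  imports Defs "HOL-Analysis.Convex"
begin

text \<open>
  Let \<open>M\<close> be the Gram matrix of an orthonormal representation of a \<open>C\<^bsub>2t+1\<^esub>\<close>-free graph. By an argument
  of Erdos, Faudree, Rousseau and Schelp, every breadth-first layer at distance at most \<open>t\<close> from a
  vertex \<open>v\<close> is \<open>O(t)\<close>-colourable; using disjoint palettes for even and odd layers, so is the ball of
  radius \<open>t\<close>, with \<open>K = 4t\<close> colours. A colour class is a set of orthonormal vectors, hence
  \<open>x\<^sup>T M x \<le> K x\<^sup>T x\<close> for every \<open>x\<close> supported on the ball. The vectors \<open>M\<^sup>k e\<^sub>v\<close> with \<open>k \<le> t\<close> are supported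
  there, so \<open>y\<^sup>T M y \<le> K\<^bsup>2t+1\<^esup>\<close> for \<open>y = M\<^sup>t e\<^sub>v\<close>. If \<open>M x = \<mu> x\<close> then \<open>y\<^sup>T M x = \<mu>\<^bsup>t+1\<^esup> x\<^sub>v\<close>, and the
  Cauchy-Schwarz inequality for the form \<open>M\<close>, summed over all \<open>v\<close>, gives \<open>\<mu>\<^bsup>2t+1\<^esup> \<le> n K\<^bsup>2t+1\<^esup>\<close>.
\<close>

section \<open>Colouring balls of a graph without a given odd cycle\<close>

text \<open>The forbidden subgraph is the image of the cycle under \<open>\<phi>\<close>, built with
  \<open>app_iso\<close>. The hypothesis \<open>arc\<close> gives one orientation of each cycle edge
  and \<open>sym\<close> the other.\<close>

lemma not_H_free_cycle_graphI:
  assumes wf: "wf_digraph (with_proj G)"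
    and inj: "inj_on \<phi> {..<k}" and sym: "sym (parcs G)"
    and arc: "\<And>i. i < k \<Longrightarrow> (\<phi> i, \<phi> (Suc i mod k)) \<in> parcs G"
  shows "\<not> H_free (cycle_graph k) G"
proof -
  define h where "h = \<lparr>iso_verts = \<phi>, iso_arcs = map_prod \<phi> \<phi>, iso_head = snd, iso_tail = fst\<rparr>"
  let ?H = "with_proj (cycle_graph k)"
  have wfH: "wf_digraph ?H"
    by unfold_locales (auto simp: cycle_graph_def)
  have "inj_on (map_prod \<phi> \<phi>) (parcs (cycle_graph k))"
    by (rule inj_on_subset[OF map_prod_inj_on[OF inj inj]]) (auto simp: cycle_graph_def)
  then have iso: "pre_digraph.digraph_isomorphism ?H h"
    using wfH inj by (auto simp: pre_digraph.digraph_isomorphism_def h_def cycle_graph_def)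
  define K where "K = app_iso h ?H"
  have "wf_digraph K"
    unfolding K_def by (rule wf_digraph.wf_digraphI_app_iso[OF wfH iso])
  moreover have arcs: "arcs K \<subseteq> parcs G"
    using arc sym by (auto simp: K_def h_def cycle_graph_def dest: symD)
  moreover have "verts K \<subseteq> pverts G"
  proof
    fix u assume "u \<in> verts K"
    then obtain i where "i < k" "u = \<phi> i"
      by (auto simp: K_def h_def cycle_graph_def)
    with arc[of i] show "u \<in> pverts G"
      using wf_digraph.tail_in_verts[OF wf] by force
  qed
  ultimately have "subgraph K (with_proj G)"
    using wf by (auto simp: subgraph_def compatible_def K_def h_def)
  moreover have "digraph_iso K ?H"
    by (rule digraph_iso_swap[OF wfH]) (use iso K_def in \<open>auto simp: digraph_iso_def\<close>)
  ultimately show ?thesis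
    unfolding H_free_def by blast
qed

text \<open>
  With \<open>p\<close> the parent map of a tree on vertices below \<open>N\<close>, this reads the ancestors of a vertex at
  depth \<open>k\<close>, listed from the root, as the digits of a number in base \<open>N\<close>. It thus encodes the
  lexicographic order of root paths, and passing to the parent is division by \<open>N\<close>.
\<close>

primrec tree_rank :: "nat \<Rightarrow> (nat \<Rightarrow> nat) \<Rightarrow> nat \<Rightarrow> nat \<Rightarrow> nat" where
  "tree_rank N p 0 u = u"
| "tree_rank N p (Suc k) u = tree_rank N p k (p u) * N + u"

lemma tree_rank_inj:
  assumes "u < N" "w < N" "tree_rank N p k u = tree_rank N p k w"
  shows "u = w"
proof (cases k)
  case (Suc j)
  then have "(tree_rank N p j (p u) * N + u) mod N = (tree_rank N p j (p w) * N + w) mod N"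
    using assms by simp
  with assms show ?thesis by simp
qed (use assms in simp)

lemma tree_rank_mono_ancestor:
  assumes "\<And>j. j \<le> k \<Longrightarrow> (p ^^ j) u < N" "\<And>j. j \<le> k \<Longrightarrow> (p ^^ j) w < N"
    and "tree_rank N p (k + m) u \<le> tree_rank N p (k + m) w"
  shows "tree_rank N p m ((p ^^ k) u) \<le> tree_rank N p m ((p ^^ k) w)"
  using assms
proof (induction k arbitrary: u w)
  case (Suc k)
  have "tree_rank N p (k + m) (p u) = tree_rank N p (Suc k + m) u div N"
    "tree_rank N p (k + m) (p w) = tree_rank N p (Suc k + m) w div N"
    using Suc.prems(1,2)[of 0] by simp_all
  then have "tree_rank N p (k + m) (p u) \<le> tree_rank N p (k + m) (p w)"
    using div_le_mono[OF Suc.prems(3), of N] by metis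
  moreover have "(p ^^ j) (p x) = (p ^^ Suc j) x" for j x
    by (simp only: funpow_Suc_right o_apply)
  ultimately show ?case
    using Suc.IH[of "p u" "p w"] Suc.prems(1,2)[of "Suc _"] by (metis Suc_le_mono)
qed simp

section \<open>Rank-increasing paths in the layers of a rooted tree\<close>

text \<open>The properties of a breadth-first tree that the cycle argument uses: root
  \<open>v\<close>, parent map \<open>p\<close>, depth \<open>d\<close>. Edges of \<open>E\<close>
  outside the tree are unrestricted here.\<close>

locale rooted_layering =
  fixes E :: "(nat \<times> nat) set" and N v :: nat and R :: "nat set" and d p :: "nat \<Rightarrow> nat"
  assumes sym_E: "sym E" and R_bound: "\<And>u. u \<in> R \<Longrightarrow> u < N"
    and depth_0: "\<And>u. u \<in> R \<Longrightarrow> d u = 0 \<Longrightarrow> u = v"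
    and parent_edge: "\<And>u. u \<in> R \<Longrightarrow> 0 < d u \<Longrightarrow> (p u, u) \<in> E"
    and parent_mem: "\<And>u. u \<in> R \<Longrightarrow> 0 < d u \<Longrightarrow> p u \<in> R"
    and depth_parent: "\<And>u. u \<in> R \<Longrightarrow> 0 < d u \<Longrightarrow> d (p u) = d u - 1"
begin

lemma ancestor: "u \<in> R \<Longrightarrow> j \<le> d u \<Longrightarrow> (p ^^ j) u \<in> R \<and> d ((p ^^ j) u) = d u - j"
proof (induction j)
  case (Suc j)
  then have "(p ^^ j) u \<in> R" "d ((p ^^ j) u) = d u - j" by auto
  with Suc.prems show ?case
    using parent_mem depth_parent by auto
qed simp

lemma ancestor_edge: "u \<in> R \<Longrightarrow> j < d u \<Longrightarrow> ((p ^^ Suc j) u, (p ^^ j) u) \<in> E"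
  using ancestor[of u j] parent_edge[of "(p ^^ j) u"] by simp

lemma ancestor_root: "u \<in> R \<Longrightarrow> (p ^^ d u) u = v"
  using ancestor[of u "d u"] depth_0 by auto

text \<open>Ranks are compared only within a layer, where all root paths have equally many
  digits.\<close>

definition rank :: "nat \<Rightarrow> nat" where
  "rank u = tree_rank N p (d u) u"

lemma rank_inj: "u \<in> R \<Longrightarrow> w \<in> R \<Longrightarrow> d u = d w \<Longrightarrow> rank u = rank w \<Longrightarrow> u = w"
  unfolding rank_def using tree_rank_inj R_bound by metis

text \<open>Going up \<open>j\<close> levels drops the last \<open>j\<close> digits, which preserves
  the weak lexicographic order.\<close>

lemma rank_mono_ancestor:
  assumes "u \<in> R" "w \<in> R" "d u = d w" "rank u \<le> rank w" "j \<le> d u"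
  shows "rank ((p ^^ j) u) \<le> rank ((p ^^ j) w)"
proof -
  have "tree_rank N p (d u - j) ((p ^^ j) u) \<le> tree_rank N p (d u - j) ((p ^^ j) w)"
    by (rule tree_rank_mono_ancestor) (use assms ancestor R_bound in \<open>auto simp: rank_def\<close>)
  then show ?thesis
    using assms ancestor by (simp add: rank_def)
qed

text \<open>The cycle consists of the path \<open>q 0, \<dots>, q l\<close> closed through the tree.\<close>

lemma cycle_through_tree:
  assumes q: "\<And>j. j \<le> l \<Longrightarrow> q j \<in> R \<and> d (q j) = i" and q_inj: "inj_on q {..l}"
    and q_edge: "\<And>j. j < l \<Longrightarrow> (q j, q (Suc j)) \<in> E"
    and h: "0 < h" "h \<le> i" "(p ^^ h) (q 0) = (p ^^ h) (q l)"
    and distinct: "\<And>j. j < h \<Longrightarrow> (p ^^ j) (q 0) \<noteq> (p ^^ j) (q l)"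
  shows "\<exists>\<phi>. inj_on \<phi> {..<l + 2 * h} \<and> (\<forall>j<l + 2 * h. (\<phi> j, \<phi> (Suc j mod (l + 2 * h))) \<in> E)"
proof -
  \<comment> \<open>Follow the path, climb from \<open>q l\<close> to the common ancestor at
    \<open>l + h\<close>, then descend to \<open>q 0\<close>.\<close>
  define \<phi> where "\<phi> m = (if m \<le> l then q m else if m \<le> l + h then (p ^^ (m - l)) (q l)
    else (p ^^ (l + 2 * h - m)) (q 0))" for m
  have anc: "(p ^^ j) (q m) \<in> R" "d ((p ^^ j) (q m)) = i - j" if "j \<le> i" "m \<le> l" for j m
    using ancestor[of "q m" j] q that by auto
  define e where "e m = (if m \<le> l then 0 else if m \<le> l + h then m - l else l + 2 * h - m)" for m
  have e_le: "e m \<le> i" for m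
    using h by (auto simp: e_def)
  have depth_\<phi>: "d (\<phi> m) = i - e m" for m
    using q anc(2)[OF e_le, of l m] anc(2)[OF e_le, of 0 m] by (auto simp: \<phi>_def e_def)
  have "inj_on \<phi> {..<l + 2 * h}"
  proof (rule linorder_inj_onI')
    fix m m' assume *: "m \<in> {..<l + 2 * h}" "m' \<in> {..<l + 2 * h}" "m < m'"
    show "\<phi> m \<noteq> \<phi> m'"
    proof
      assume eq: "\<phi> m = \<phi> m'"
      then have "i - e m = i - e m'" by (simp flip: depth_\<phi>)
      then have "e m = e m'" using e_le[of m] e_le[of m'] by linarith
      \<comment> \<open>Positions of equal depth are both on the path or face each other on the two
        branches; the apex \<open>l + h\<close> is alone at its depth.\<close>
      then have "m' \<le> l \<or> l < m \<and> m < l + h \<and> l + h < m' \<and> l + 2 * h - m' = m - l"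
        using * unfolding e_def
        by (cases "m' \<le> l"; cases "m \<le> l"; cases "m \<le> l + h"; cases "m' \<le> l + h"; simp; linarith)
      then consider "m' \<le> l" | "l < m" "m < l + h" "l + h < m'" "l + 2 * h - m' = m - l" by blast
      then show False
      proof cases
        case 1
        then show ?thesis using eq * inj_onD[OF q_inj, of m m'] by (auto simp: \<phi>_def)
      next
        case 2
        then have "(p ^^ (m - l)) (q 0) = (p ^^ (m - l)) (q l)" "m - l < h"
          using eq by (auto simp: \<phi>_def)
        then show ?thesis using distinct by blast
      qed
    qed
  qed
  moreover have "(\<phi> m, \<phi> (Suc m mod (l + 2 * h))) \<in> E" if m: "m < l + 2 * h" for m
  proof -
    \<comment> \<open>One index past the cycle the third branch has exponent 0, so the formula wraps
      around by itself.\<close>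
    have last: "\<phi> (l + 2 * h) = q 0" using h by (auto simp: \<phi>_def)
    have "\<phi> (Suc m mod (l + 2 * h)) = \<phi> (Suc m)"
    proof (cases "Suc m = l + 2 * h")
      case True
      then show ?thesis using last by (simp add: \<phi>_def)
    qed (use m in simp)
    moreover have "(\<phi> m, \<phi> (Suc m)) \<in> E"
    proof -
      consider "m < l" | "l \<le> m" "m < l + h" | "l + h \<le> m" by linarith
      then show ?thesis
      proof cases
        case 1
        then show ?thesis using q_edge by (simp add: \<phi>_def)
      next
        case 2
        then have "\<phi> m = (p ^^ (m - l)) (q l)" "\<phi> (Suc m) = (p ^^ Suc (m - l)) (q l)"
          by (auto simp: \<phi>_def Suc_diff_le)
        moreover have "((p ^^ Suc (m - l)) (q l), (p ^^ (m - l)) (q l)) \<in> E"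
          by (rule ancestor_edge) (use q[of l] 2 h in auto)
        ultimately show ?thesis using symD[OF sym_E] by metis
      next
        case 3
        define j where "j = l + 2 * h - Suc m"
        have "\<phi> m = (p ^^ Suc j) (q 0)"
        \<comment> \<open>The apex is defined through \<open>q l\<close>; the common ancestor
          equation in \<open>h\<close> expresses it through \<open>q 0\<close>.\<close>
        proof (cases "m = l + h")
          case True
          then have "Suc j = h" using h by (simp add: j_def)
          then show ?thesis using True h by (simp add: \<phi>_def del: funpow.simps)
        next
          case False
          then have "Suc j = l + 2 * h - m" using m by (simp add: j_def)
          then show ?thesis using 3 False by (simp add: \<phi>_def del: funpow.simps)
        qed
        moreover have "\<phi> (Suc m) = (p ^^ j) (q 0)" using 3 h by (auto simp: \<phi>_def j_def)
        moreover have "((p ^^ Suc j) (q 0), (p ^^ j) (q 0)) \<in> E"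
          by (rule ancestor_edge) (use q[of 0] 3 h in \<open>auto simp: j_def\<close>)
        ultimately show ?thesis by metis
      qed
    qed
    ultimately show ?thesis by simp
  qed
  ultimately show ?thesis by blast
qed

text \<open>
  The height of the least common ancestor of two vertices of a rank-increasing path is the maximum
  \<open>h\<close> over the steps between them. Take a step attaining the maximum over the whole path: any
  segment of \<open>2 * t + 1 - 2 * h\<close> steps around it closes up through the tree to a cycle
  of length \<open>2 * t + 1\<close>.
\<close>

lemma cycle_of_increasing_path:
  assumes t: "1 \<le> t" "i \<le> t"
    and q: "\<And>j. j \<le> 2 * t - 1 \<Longrightarrow> q j \<in> R \<and> d (q j) = i"
    and q_edge: "\<And>j. j < 2 * t - 1 \<Longrightarrow> (q j, q (Suc j)) \<in> E"
    and q_rank: "\<And>j. j < 2 * t - 1 \<Longrightarrow> rank (q j) < rank (q (Suc j))"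
  shows "\<exists>\<phi>. inj_on \<phi> {..<2 * t + 1} \<and> (\<forall>j<2 * t + 1. (\<phi> j, \<phi> (Suc j mod (2 * t + 1))) \<in> E)"
proof -
  \<comment> \<open>The longest segment that may be required, namely for
    \<open>h = 1\<close>.\<close>
  define M where "M = 2 * t - 1"
  have rank_less: "rank (q a) < rank (q b)" if "a < b" "b \<le> M" for a b
    using that
  proof (induction b)
    case (Suc b)
    then show ?case using q_rank[of b] by (cases "a = b") (auto simp: M_def)
  qed simp
  have q_inj: "inj_on q {..M}"
    by (rule linorder_inj_onI') (use rank_less in fastforce)
  define H where "H s = (LEAST h. (p ^^ h) (q s) = (p ^^ h) (q (Suc s)))" for s
  have root: "(p ^^ i) (q s) = v" if "s \<le> M" for s
    using ancestor_root[of "q s"] q[of s] that by (auto simp: M_def)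
  have H_eq: "(p ^^ H s) (q s) = (p ^^ H s) (q (Suc s))" if "s < M" for s
    unfolding H_def by (rule LeastI[of _ i]) (use root that in auto)
  have H_le: "H s \<le> i" if "s < M" for s
    unfolding H_def by (rule Least_le) (use root that in auto)
  have H_min: "(p ^^ j) (q s) \<noteq> (p ^^ j) (q (Suc s))" if "j < H s" for j s
    using that not_less_Least unfolding H_def by blast
  define h where "h = Max (H ` {..<M})"
  have M: "M > 0" using t by (simp add: M_def)
  have "h \<in> H ` {..<M}" unfolding h_def using M by (intro Max_in) auto
  then obtain s where s: "s < M" "H s = h" by auto
  have "(p ^^ h) (q j) = (p ^^ h) (q (Suc j))" if "j < M" for j
  proof -
    have "H j \<le> h" unfolding h_def using that by (intro Max_ge) auto
    then have "p ^^ h = p ^^ (h - H j) \<circ> p ^^ H j" by (simp flip: funpow_add)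
    then show ?thesis using H_eq[OF that] by simp
  qed
  then have same: "(p ^^ h) (q j) = (p ^^ h) (q 0)" if "j \<le> M" for j
    using that by (induction j) auto
  have hi: "h \<le> i" using H_le s by auto
  have h0: "0 < h"
  proof (rule ccontr)
    assume "\<not> 0 < h"
    then have "q s = q (Suc s)" using H_eq[of s] s by simp
    then show False using rank_less[of s "Suc s"] s by simp
  qed
  define l where "l = 2 * t + 1 - 2 * h"
  have l: "1 \<le> l" "l \<le> M" "l + 2 * h = 2 * t + 1"
    using hi t(2) h0 unfolding l_def M_def by linarith+
  \<comment> \<open>The window of \<open>l\<close> steps starts at \<open>s\<close>, shifted left if
    it would overrun the path; it still contains the step from \<open>s\<close> to
    \<open>Suc s\<close>.\<close>
  define a where "a = min s (M - l)"
  have a: "a \<le> s" "Suc s \<le> a + l" "a + l \<le> M"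
    using l s by (auto simp: a_def)
  have distinct: "(p ^^ j) (q a) \<noteq> (p ^^ j) (q (a + l))" if "j < h" for j
  proof
    assume eq: "(p ^^ j) (q a) = (p ^^ j) (q (a + l))"
    have mono: "rank ((p ^^ j) (q b)) \<le> rank ((p ^^ j) (q c))" if "b \<le> c" "c \<le> M" for b c
      by (rule rank_mono_ancestor)
        (use that q[of b] q[of c] rank_less[of b c] \<open>j < h\<close> hi in
          \<open>auto simp: M_def le_less\<close>)
    \<comment> \<open>Ancestor ranks increase weakly along the window, so equality at its ends
      forces equality across step \<open>s\<close>, against the minimality of
      \<open>H s = h\<close>.\<close>
    have "rank ((p ^^ j) (q s)) = rank ((p ^^ j) (q (Suc s)))"
      using mono[of a s] mono[of s "Suc s"] mono[of "Suc s" "a + l"] eq a s by auto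
    moreover have "(p ^^ j) (q b) \<in> R" "d ((p ^^ j) (q b)) = i - j" if "b \<le> M" for b
      using ancestor[of "q b" j] q[of b] that \<open>j < h\<close> hi by (auto simp: M_def)
    ultimately have "(p ^^ j) (q s) = (p ^^ j) (q (Suc s))"
      using rank_inj[of "(p ^^ j) (q s)" "(p ^^ j) (q (Suc s))"] s by auto
    then show False using H_min[of j s] s that by simp
  qed
  have "\<exists>\<phi>. inj_on \<phi> {..<l + 2 * h} \<and> (\<forall>j<l + 2 * h. (\<phi> j, \<phi> (Suc j mod (l + 2 * h))) \<in> E)"
  proof (rule cycle_through_tree[where q = "\<lambda>j. q (a + j)"])
    show "inj_on (\<lambda>j. q (a + j)) {..l}"
      using a by (intro inj_onI) (auto dest!: inj_onD[OF q_inj])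
    show "(p ^^ h) (q (a + 0)) = (p ^^ h) (q (a + l))"
      using same[of a] same[of "a + l"] a by simp
  qed (use q q_edge a h0 hi distinct in \<open>auto simp: M_def\<close>)
  then show ?thesis using l by simp
qed

text \<open>A vertex is coloured by the length of a longest rank-increasing path ending in it.\<close>

lemma layer_coloring:
  assumes t: "1 \<le> t"
    and no_cycle: "\<not> (\<exists>\<phi>. inj_on \<phi> {..<2 * t + 1} \<and>
      (\<forall>j<2 * t + 1. (\<phi> j, \<phi> (Suc j mod (2 * t + 1))) \<in> E))"
  obtains c :: "nat \<Rightarrow> nat" where
    "\<And>u. u \<in> R \<Longrightarrow> d u \<le> t \<Longrightarrow> c u < 2 * t"
    "\<And>u w. u \<in> R \<Longrightarrow> w \<in> R \<Longrightarrow> d u = d w \<Longrightarrow> d u \<le> t \<Longrightarrow> u \<noteq> w \<Longrightarrow> (u, w) \<in> E \<Longrightarrow> c u \<noteq> c w"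
proof -
  define P where "P m u \<longleftrightarrow> (\<exists>q. q m = u \<and> (\<forall>j\<le>m. q j \<in> R \<and> d (q j) = d u) \<and>
    (\<forall>j<m. (q j, q (Suc j)) \<in> E \<and> rank (q j) < rank (q (Suc j))))" for m :: nat and u
  have bound: "m < 2 * t - 1" if "P m u" "d u \<le> t" for m u
  proof (rule ccontr)
    assume m: "\<not> m < 2 * t - 1"
    from \<open>P m u\<close> obtain q where q: "\<And>j. j \<le> m \<Longrightarrow> q j \<in> R \<and> d (q j) = d u"
      "\<And>j. j < m \<Longrightarrow> (q j, q (Suc j)) \<in> E \<and> rank (q j) < rank (q (Suc j))"
      unfolding P_def by blast
    show False
      using cycle_of_increasing_path[OF t \<open>d u \<le> t\<close>, of q] q m no_cycle by auto
  qed
  have P0: "P 0 u" if "u \<in> R" for u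
    unfolding P_def using that by (intro exI[of _ "\<lambda>_. u"]) auto
  have PSuc: "P (Suc m) w"
    if "P m u" "w \<in> R" "d u = d w" "(u, w) \<in> E" "rank u < rank w" for m u w
  proof -
    from \<open>P m u\<close> obtain q where "q m = u" "\<forall>j\<le>m. q j \<in> R \<and> d (q j) = d u"
      "\<forall>j<m. (q j, q (Suc j)) \<in> E \<and> rank (q j) < rank (q (Suc j))"
      unfolding P_def by blast
    then show ?thesis
      unfolding P_def using that by (intro exI[of _ "q(Suc m := w)"]) (auto simp: less_Suc_eq le_Suc_eq)
  qed
  define c where "c u = (GREATEST m. P m u)" for u
  have Pc: "P (c u) u" if "u \<in> R" "d u \<le> t" for u
    unfolding c_def
    by (rule GreatestI_nat[where b = "2 * t"]) (use P0[OF that(1)] bound that in \<open>auto simp: less_imp_le\<close>, fastforce)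
  have c_ge: "m \<le> c u" if "P m u" "d u \<le> t" for m u
    unfolding c_def
    by (rule Greatest_le_nat[where b = "2 * t"]) (use bound that in \<open>auto simp: less_imp_le\<close>, fastforce)
  have less: "c u < c w"
    if "u \<in> R" "w \<in> R" "d u = d w" "d u \<le> t" "(u, w) \<in> E" "rank u < rank w" for u w
    using c_ge[OF PSuc[OF Pc]] that by force
  show ?thesis
  proof (rule that)
    show "c u < 2 * t" if "u \<in> R" "d u \<le> t" for u
      using bound[OF Pc] that by force
    \<comment> \<open>Since \<open>rank\<close> is injective on a layer, it orients each edge there,
      and the colour grows along that orientation.\<close>
    show "c u \<noteq> c w" if "u \<in> R" "w \<in> R" "d u = d w" "d u \<le> t" "u \<noteq> w" "(u, w) \<in> E" for u w
      using less[of u w] less[of w u] rank_inj[of u w] that sym_E by (metis less_irrefl linorder_neqE_nat symD)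
  qed
qed

end

section \<open>Combining the layers of a ball\<close>

lemma ball_coloring:
  fixes E :: "(nat \<times> nat) set"
  assumes "sym E" and E: "E \<subseteq> {..<N} \<times> {..<N}" and v: "v < N" and t: "1 \<le> t"
    and no_cycle: "\<not> (\<exists>\<phi>. inj_on \<phi> {..<2 * t + 1} \<and>
      (\<forall>j<2 * t + 1. (\<phi> j, \<phi> (Suc j mod (2 * t + 1))) \<in> E))"
  obtains c :: "nat \<Rightarrow> nat" where
    "\<And>u k. k \<le> t \<Longrightarrow> (v, u) \<in> E ^^ k \<Longrightarrow> c u < 4 * t"
    "\<And>u w k l. k \<le> t \<Longrightarrow> (v, u) \<in> E ^^ k \<Longrightarrow> l \<le> t \<Longrightarrow> (v, w) \<in> E ^^ l \<Longrightarrow>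
      u \<noteq> w \<Longrightarrow> (u, w) \<in> E \<Longrightarrow> c u \<noteq> c w"
proof -
  define R where "R = {u. (v, u) \<in> E\<^sup>*}"
  define d where "d u = (LEAST k. (v, u) \<in> E ^^ k)" for u
  have d_le: "d u \<le> k" if "(v, u) \<in> E ^^ k" for u k
    unfolding d_def using that by (rule Least_le)
  have d_mem: "(v, u) \<in> E ^^ d u" if "u \<in> R" for u
  proof -
    from that obtain k where "(v, u) \<in> E ^^ k" by (auto simp: R_def rtrancl_power)
    then show ?thesis unfolding d_def by (rule LeastI)
  qed
  have R_I: "u \<in> R" if "(v, u) \<in> E ^^ k" for u k
    using that by (auto simp: R_def rtrancl_power)
  have d_step: "d w \<le> Suc (d u)" if "u \<in> R" "(u, w) \<in> E" for u w
    using d_mem[OF that(1)] that(2) by (intro d_le) auto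
  have "\<exists>w. (w, u) \<in> E \<and> w \<in> R \<and> d w = d u - 1" if "u \<in> R" "0 < d u" for u
  proof -
    obtain k where k: "d u = Suc k" using \<open>0 < d u\<close> gr0_conv_Suc by blast
    then have "(v, u) \<in> E ^^ Suc k" using d_mem[OF \<open>u \<in> R\<close>] by simp
    then obtain w where w: "(v, w) \<in> E ^^ k" "(w, u) \<in> E" by auto
    \<comment> \<open>The last vertex before \<open>u\<close> on a shortest walk has depth at most
      \<open>k\<close> by that walk, and at least \<open>k\<close> by \<open>d_step\<close>.\<close>
    then show ?thesis using d_le[OF w(1)] d_step[OF R_I[OF w(1)] w(2)] R_I[OF w(1)] k by auto
  qed
  then obtain p where p: "\<And>u. u \<in> R \<Longrightarrow> 0 < d u \<Longrightarrow> (p u, u) \<in> E \<and> p u \<in> R \<and> d (p u) = d u - 1"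
    by metis
  interpret rooted_layering E N v R d p
  proof
    show "u < N" if "u \<in> R" for u
      using that E v unfolding R_def by (auto elim: rtranclE)
    show "u = v" if "u \<in> R" "d u = 0" for u
      using d_mem[OF that(1)] that(2) by simp
  qed (use \<open>sym E\<close> p in auto)
  obtain c :: "nat \<Rightarrow> nat" where c: "\<And>u. u \<in> R \<Longrightarrow> d u \<le> t \<Longrightarrow> c u < 2 * t"
    "\<And>u w. u \<in> R \<Longrightarrow> w \<in> R \<Longrightarrow> d u = d w \<Longrightarrow> d u \<le> t \<Longrightarrow> u \<noteq> w \<Longrightarrow> (u, w) \<in> E \<Longrightarrow> c u \<noteq> c w"
    using layer_coloring[OF t no_cycle] by blast
  show ?thesis
  proof (rule that)
    \<comment> \<open>adjacent vertices of different layers are separated by the parity of the depth\<close>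
    fix u k assume u: "k \<le> t" "(v, u) \<in> E ^^ k"
    then have "c u < 2 * t" by (intro c) (auto dest: R_I d_le)
    then show "2 * c u + d u mod 2 < 4 * t" by linarith
  next
    fix u w k l assume uw: "k \<le> t" "(v, u) \<in> E ^^ k" "l \<le> t" "(v, w) \<in> E ^^ l" "u \<noteq> w" "(u, w) \<in> E"
    show "2 * c u + d u mod 2 \<noteq> 2 * c w + d w mod 2"
    proof
      assume eq: "2 * c u + d u mod 2 = 2 * c w + d w mod 2"
      have R: "u \<in> R" "w \<in> R" "d u \<le> t" using uw R_I d_le[of u k] by auto
      then have "c u = c w" using arg_cong[OF eq, of "\<lambda>m. m div 2"] by simp
      have "d u \<le> Suc (d w)" "d w \<le> Suc (d u)"
        using d_step[of u w] d_step[of w u] R uw symD[OF \<open>sym E\<close>] by blast+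
      then have "d u = d w \<or> d u = Suc (d w) \<or> d w = Suc (d u)" by linarith
      moreover have "d u mod 2 = d w mod 2" using eq \<open>c u = c w\<close> by simp
      ultimately have "d u = d w" by (auto simp: mod_Suc split: if_splits)
      then show False using c(2)[of u w] R uw \<open>c u = c w\<close> by simp
    qed
  qed
qed

section \<open>Powers of a Gram matrix\<close>

locale gram_kernel =
  fixes n D :: nat and F :: "nat \<Rightarrow> nat \<Rightarrow> real"
begin

definition M :: "nat \<Rightarrow> nat \<Rightarrow> real" where
  "M u w = (\<Sum>l<D. F u l * F w l)"

definition app :: "(nat \<Rightarrow> real) \<Rightarrow> nat \<Rightarrow> real" where
  "app x u = (\<Sum>w<n. M u w * x w)"

definition ip :: "(nat \<Rightarrow> real) \<Rightarrow> (nat \<Rightarrow> real) \<Rightarrow> real" where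
  "ip x y = (\<Sum>u<n. x u * y u)"

text \<open>Writes the form of \<open>M\<close> as the inner product of the combinations of the rows
  of \<open>F\<close> with coefficients \<open>x\<close> and \<open>y\<close>; nonnegativity and
  Cauchy-Schwarz follow.\<close>

lemma ip_app: "ip x (app y) = (\<Sum>l<D. (\<Sum>u<n. x u * F u l) * (\<Sum>u<n. y u * F u l))"
proof -
  have "ip x (app y) = (\<Sum>u<n. \<Sum>w<n. \<Sum>l<D. (x u * F u l) * (y w * F w l))"
    by (simp add: ip_def app_def M_def sum_distrib_left sum_distrib_right mult_ac)
  also have "\<dots> = (\<Sum>u<n. \<Sum>l<D. \<Sum>w<n. (x u * F u l) * (y w * F w l))"
    by (intro sum.cong refl sum.swap)
  also have "\<dots> = (\<Sum>l<D. \<Sum>u<n. \<Sum>w<n. (x u * F u l) * (y w * F w l))"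
    by (rule sum.swap)
  finally show ?thesis by (simp add: sum_product)
qed

lemma ip_app_sym: "ip (app x) y = ip x (app y)"
proof -
  have "ip (app x) y = ip y (app x)" by (simp add: ip_def mult.commute)
  then show ?thesis by (simp add: ip_app mult.commute)
qed

lemma ip_app_self: "ip x (app x) = (\<Sum>l<D. (\<Sum>u<n. x u * F u l)\<^sup>2)"
  by (simp add: ip_app power2_eq_square)

lemma ip_app_Cauchy_Schwarz: "(ip x (app y))\<^sup>2 \<le> ip x (app x) * ip y (app y)"
  unfolding ip_app_self unfolding ip_app by (rule Cauchy_Schwarz_ineq_sum)

text \<open>By Pythagoras a colour class contributes a vector of squared norm equal to its sum of
  \<open>(x u)\<^sup>2\<close>. Adding the \<open>K\<close> class vectors costs a factor
  \<open>K\<close>.\<close>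

lemma ip_app_self_le_coloring:
  assumes supp: "\<And>u. u < n \<Longrightarrow> x u \<noteq> 0 \<Longrightarrow> u \<in> B"
    and c: "\<And>u. u \<in> B \<Longrightarrow> u < n \<Longrightarrow> c u < K"
    and orth: "\<And>u w. u \<in> B \<Longrightarrow> w \<in> B \<Longrightarrow> u < n \<Longrightarrow> w < n \<Longrightarrow> u \<noteq> w \<Longrightarrow> c u = c w \<Longrightarrow> M u w = 0"
    and unit: "\<And>u. u < n \<Longrightarrow> M u u = 1"
  shows "ip x (app x) \<le> real K * ip x x"
proof -
  define S where "S = B \<inter> {..<n}"
  define S' where "S' k = {u \<in> S. c u = k}" for k
  have fin: "finite S" "finite (S' k)" for k by (auto simp: S_def S'_def)
  have restrict: "(\<Sum>u<n. g u) = (\<Sum>k<K. \<Sum>u\<in>S' k. g u)" if "\<And>u. x u = 0 \<Longrightarrow> g u = 0" for g :: "nat \<Rightarrow> real"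
  proof -
    have "(\<Sum>u<n. g u) = (\<Sum>u\<in>S. g u)"
      by (rule sum.mono_neutral_right) (use supp that in \<open>auto simp: S_def\<close>)
    also have "\<dots> = (\<Sum>k<K. \<Sum>u\<in>S' k. g u)"
      unfolding S'_def by (rule sum.group[symmetric]) (use fin c in \<open>auto simp: S_def\<close>)
    finally show ?thesis .
  qed
  have class_sum: "(\<Sum>l<D. (\<Sum>u\<in>S' k. x u * F u l)\<^sup>2) = (\<Sum>u\<in>S' k. (x u)\<^sup>2)" for k
  proof -
    have "(\<Sum>l<D. (\<Sum>u\<in>S' k. x u * F u l)\<^sup>2) =
        (\<Sum>l<D. \<Sum>u\<in>S' k. \<Sum>w\<in>S' k. x u * F u l * (x w * F w l))"
      by (simp add: power2_eq_square sum_product)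
    also have "\<dots> = (\<Sum>u\<in>S' k. \<Sum>l<D. \<Sum>w\<in>S' k. x u * F u l * (x w * F w l))"
      by (rule sum.swap)
    also have "\<dots> = (\<Sum>u\<in>S' k. \<Sum>w\<in>S' k. \<Sum>l<D. x u * F u l * (x w * F w l))"
      by (intro sum.cong refl sum.swap)
    also have "\<dots> = (\<Sum>u\<in>S' k. \<Sum>w\<in>S' k. x u * x w * M u w)"
      by (simp add: M_def sum_distrib_left mult_ac)
    also have "\<dots> = (\<Sum>u\<in>S' k. \<Sum>w\<in>S' k. if w = u then (x u)\<^sup>2 else 0)"
      by (intro sum.cong refl) (use orth unit in \<open>auto simp: S_def S'_def power2_eq_square\<close>)
    also have "\<dots> = (\<Sum>u\<in>S' k. (x u)\<^sup>2)"
      using fin by simp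
    finally show ?thesis .
  qed
  have "ip x (app x) = (\<Sum>l<D. (\<Sum>k<K. \<Sum>u\<in>S' k. x u * F u l)\<^sup>2)"
    unfolding ip_app_self by (subst restrict) auto
  also have "\<dots> \<le> (\<Sum>l<D. (\<Sum>k<K. (\<Sum>u\<in>S' k. x u * F u l)\<^sup>2) * real (card {..<K}))"
    by (intro sum_mono sum_squared_le_sum_of_squares)
  also have "\<dots> = real K * (\<Sum>l<D. \<Sum>k<K. (\<Sum>u\<in>S' k. x u * F u l)\<^sup>2)"
    by (simp add: sum_distrib_left mult.commute)
  also have "(\<Sum>l<D. \<Sum>k<K. (\<Sum>u\<in>S' k. x u * F u l)\<^sup>2) = (\<Sum>k<K. \<Sum>u\<in>S' k. (x u)\<^sup>2)"
    by (subst sum.swap) (simp add: class_sum)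
  also have "\<dots> = (\<Sum>u<n. (x u)\<^sup>2)"
    by (rule restrict[symmetric]) simp
  finally show ?thesis by (simp add: ip_def power2_eq_square)
qed

section \<open>Iterating the kernel on a basis vector\<close>

definition basis :: "nat \<Rightarrow> nat \<Rightarrow> real" where
  "basis v u = (if u = v then 1 else 0)"

text \<open>For \<open>z = app y\<close>, Cauchy-Schwarz and \<open>quad\<close> give
  \<open>ip z z * ip z z \<le> K * ip z z * ip y (app y)\<close>, so
  \<open>ip z z \<le> K * ip y (app y)\<close>. A second use of \<open>quad\<close> passes to
  \<open>ip z (app z)\<close>, so each iteration costs \<open>K\<^sup>2\<close>.\<close>

lemma power_form_le:
  assumes v: "v < n" and K: "0 \<le> K"
    and quad: "\<And>k. k \<le> t \<Longrightarrow> ip ((app ^^ k) (basis v)) (app ((app ^^ k) (basis v)))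
      \<le> K * ip ((app ^^ k) (basis v)) ((app ^^ k) (basis v))"
    and "k \<le> t"
  shows "ip ((app ^^ k) (basis v)) (app ((app ^^ k) (basis v))) \<le> K ^ (2 * k + 1)"
  using \<open>k \<le> t\<close>
proof (induction k)
  case 0
  have "ip (basis v) (basis v) = 1"
    using v by (simp add: ip_def basis_def if_distrib[where f = "\<lambda>a. a * _"] cong: if_cong)
  then show ?case using quad[of 0] by simp
next
  case (Suc k)
  define y where "y = (app ^^ k) (basis v)"
  define z where "z = app y"
  have z: "(app ^^ Suc k) (basis v) = z" by (simp add: z_def y_def)
  have IH: "ip y (app y) \<le> K ^ (2 * k + 1)" using Suc by (simp add: y_def)
  have zz: "ip z (app z) \<le> K * ip z z" using quad[of "Suc k"] Suc.prems unfolding z by simp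
  have nonneg: "0 \<le> ip y (app y)" by (simp add: ip_app_self sum_nonneg)
  have "ip z z * ip z z \<le> ip z (app z) * ip y (app y)"
    using ip_app_Cauchy_Schwarz[of z y] by (simp add: z_def[symmetric] power2_eq_square)
  also have "\<dots> \<le> K * ip z z * ip y (app y)"
    using zz nonneg by (rule mult_right_mono)
  finally have "ip z z * ip z z \<le> ip z z * (K * ip y (app y))" by (simp add: mult_ac)
  moreover have "0 \<le> ip z z" by (simp add: ip_def sum_nonneg)
  ultimately have "ip z z \<le> K * ip y (app y)"
    using K nonneg by (cases "ip z z = 0") auto
  also have "\<dots> \<le> K * K ^ (2 * k + 1)"
    using IH K by (rule mult_left_mono)
  finally have "K * ip z z \<le> K * (K * K ^ (2 * k + 1))"
    using K by (rule mult_left_mono)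
  with zz show ?case unfolding z by simp
qed

lemma eigenvalue_power_le:
  assumes form: "\<And>v. v < n \<Longrightarrow> ip ((app ^^ t) (basis v)) (app ((app ^^ t) (basis v))) \<le> b"
    and eigen: "\<And>u. u < n \<Longrightarrow> app x u = \<mu> * x u" and nz: "\<exists>u<n. x u \<noteq> 0" and pos: "0 < \<mu>"
  shows "\<mu> ^ (2 * t + 1) \<le> real n * b"
proof -
  have ip_app_x: "ip y (app x) = \<mu> * ip y x" for y
    unfolding ip_def sum_distrib_left by (rule sum.cong) (simp_all add: eigen)
  have ip_power: "ip ((app ^^ k) (basis v)) x = \<mu> ^ k * x v" if "v < n" for k v
  proof (induction k)
    case 0
    show ?case
      using that by (simp add: ip_def basis_def if_distrib[where f = "\<lambda>a. a * _"] cong: if_cong)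
  qed (simp add: ip_app_sym ip_app_x)
  have xx: "0 < ip x x"
    unfolding ip_def using nz by (auto intro!: sum_pos2 simp: zero_less_mult_iff linorder_neq_iff)
  have "(\<mu> ^ (t + 1))\<^sup>2 * (x v)\<^sup>2 \<le> b * (\<mu> * ip x x)" if "v < n" for v
  proof -
    have "(\<mu> ^ (t + 1))\<^sup>2 * (x v)\<^sup>2 = (ip ((app ^^ t) (basis v)) (app x))\<^sup>2"
      using that by (simp add: ip_app_x ip_power power_mult_distrib mult_ac)
    also have "\<dots> \<le> ip ((app ^^ t) (basis v)) (app ((app ^^ t) (basis v))) * ip x (app x)"
      by (rule ip_app_Cauchy_Schwarz)
    also have "\<dots> \<le> b * ip x (app x)"
      using form[OF that] by (rule mult_right_mono) (simp add: ip_app_self sum_nonneg)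
    finally show ?thesis by (simp add: ip_app_x)
  qed
  \<comment> \<open>Summing over \<open>v\<close> turns \<open>(x v)\<^sup>2\<close> into
    \<open>ip x x\<close>, which then cancels; the price is the factor \<open>n\<close>.\<close>
  then have "(\<Sum>v<n. (\<mu> ^ (t + 1))\<^sup>2 * (x v)\<^sup>2) \<le> (\<Sum>v<n. b * (\<mu> * ip x x))"
    by (intro sum_mono) simp
  then have "(\<mu> ^ (t + 1))\<^sup>2 * ip x x \<le> real n * b * \<mu> * ip x x"
    by (simp add: ip_def power2_eq_square sum_distrib_left mult_ac)
  then have "(\<mu> ^ (t + 1))\<^sup>2 \<le> real n * b * \<mu>"
    using xx by simp
  moreover have "(\<mu> ^ (t + 1))\<^sup>2 = \<mu> ^ (2 * t + 1) * \<mu>"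
    by (simp add: power2_eq_square power_add mult_2)
  ultimately have "\<mu> ^ (2 * t + 1) * \<mu> \<le> real n * b * \<mu>" by (simp only:)
  then show ?thesis using pos by (rule mult_right_le_imp_le)
qed

text \<open>Each application of \<open>app\<close> spreads the support by at most one edge; diagonal
  entries let it stay put, hence walks of length at most \<open>k\<close>.\<close>

lemma power_basis_support:
  assumes loc: "\<And>u w. u < n \<Longrightarrow> w < n \<Longrightarrow> u \<noteq> w \<Longrightarrow> (w, u) \<notin> E \<Longrightarrow> M u w = 0"
    and "u < n" "(app ^^ k) (basis v) u \<noteq> 0"
  shows "\<exists>j\<le>k. (v, u) \<in> E ^^ j"
  using assms(2,3)
proof (induction k arbitrary: u)
  case 0
  then show ?case by (auto simp: basis_def split: if_splits)
next
  case (Suc k)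
  have "\<exists>w<n. M u w * (app ^^ k) (basis v) w \<noteq> 0"
  proof (rule ccontr)
    assume "\<not> ?thesis"
    then have "app ((app ^^ k) (basis v)) u = 0" unfolding app_def by (intro sum.neutral) auto
    with Suc.prems show False by simp
  qed
  then obtain w where w: "w < n" "M u w \<noteq> 0" "(app ^^ k) (basis v) w \<noteq> 0" by auto
  obtain j where j: "j \<le> k" "(v, w) \<in> E ^^ j" using Suc.IH[OF w(1,3)] by auto
  show ?case
  proof (cases "u = w")
    case True
    then show ?thesis using j by (intro exI[of _ j]) auto
  next
    case False
    then have "(w, u) \<in> E" using loc[OF Suc.prems(1) w(1)] w(2) by blast
    then show ?thesis using j by (intro exI[of _ "Suc j"]) auto
  qed
qed

end

section \<open>The eigenvalue bound\<close>

lemma eigenvalue_gram_mat_cycle_free_le: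
  assumes G: "pair_graph G" "pverts G = {..<n}" and free: "H_free (cycle_graph (2 * t + 1)) G"
    and t: "1 \<le> t" and rep: "orthonormal_rep G D f" and ev: "eigenvalue (gram_mat n f) \<mu>"
  shows "\<mu> \<le> 4 * real t * real n powr (1 / real (2 * t + 1))"
proof (cases "0 < \<mu>")
  case True
  interpret G: pair_graph G by (rule G(1))
  interpret gram_kernel n D "\<lambda>u l. f u $ l" .
  let ?E = "parcs G"
  have E: "?E \<subseteq> {..<n} \<times> {..<n}" using G(2) G.in_arcsD1 G.in_arcsD2 by auto
  have sym: "sym ?E" using G.sym_arcs by (auto simp: symmetric_def)
  have f: "f u \<in> carrier_vec D" "f u \<bullet> f u = 1" if "u < n" for u
    using rep that G(2) by (auto simp: orthonormal_rep_def)
  have M: "f u \<bullet> f w = M u w" if "u < n" "w < n" for u w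
    using f[OF that(2)] by (simp add: M_def scalar_prod_def atLeast0LessThan)
  have unit: "M u u = 1" if "u < n" for u
    using f M that by metis
  have orth: "M u w = 0" if "u < n" "w < n" "u \<noteq> w" "(u, w) \<notin> ?E" for u w
    using rep that G(2) M[of u w] by (auto simp: orthonormal_rep_def arcs_ends_def)
  have no_cycle: "\<not> (\<exists>\<phi>. inj_on \<phi> {..<2 * t + 1} \<and>
      (\<forall>j<2 * t + 1. (\<phi> j, \<phi> (Suc j mod (2 * t + 1))) \<in> ?E))"
    using not_H_free_cycle_graphI[OF G.wf_digraph_axioms] sym free by blast
  have form: "ip ((app ^^ t) (basis v)) (app ((app ^^ t) (basis v))) \<le> real (4 * t) ^ (2 * t + 1)"
    if v: "v < n" for v
  proof -
    obtain c :: "nat \<Rightarrow> nat" where c: "\<And>u k. k \<le> t \<Longrightarrow> (v, u) \<in> ?E ^^ k \<Longrightarrow> c u < 4 * t"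
      "\<And>u w k l. k \<le> t \<Longrightarrow> (v, u) \<in> ?E ^^ k \<Longrightarrow> l \<le> t \<Longrightarrow> (v, w) \<in> ?E ^^ l \<Longrightarrow>
        u \<noteq> w \<Longrightarrow> (u, w) \<in> ?E \<Longrightarrow> c u \<noteq> c w"
      using ball_coloring[OF sym E v t no_cycle] by blast
    show ?thesis
    proof (rule power_form_le[OF v, where t = t])
      fix k assume k: "k \<le> t"
      show "ip ((app ^^ k) (basis v)) (app ((app ^^ k) (basis v)))
          \<le> real (4 * t) * ip ((app ^^ k) (basis v)) ((app ^^ k) (basis v))"
      proof (rule ip_app_self_le_coloring[where B = "{u. \<exists>j\<le>t. (v, u) \<in> ?E ^^ j}" and c = c])
        fix u assume u: "u < n" "(app ^^ k) (basis v) u \<noteq> 0"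
        have "\<exists>j\<le>k. (v, u) \<in> ?E ^^ j"
          by (rule power_basis_support[OF _ u]) (use orth sym in \<open>auto dest: symD\<close>)
        then show "u \<in> {u. \<exists>j\<le>t. (v, u) \<in> ?E ^^ j}" using k by (auto intro: order_trans)
      next
        fix u w
        assume "u \<in> {u. \<exists>j\<le>t. (v, u) \<in> ?E ^^ j}" "w \<in> {u. \<exists>j\<le>t. (v, u) \<in> ?E ^^ j}"
          "u < n" "w < n" "u \<noteq> w" "c u = c w"
        \<comment> \<open>Contrapositive of proper colouring: distinct vertices of equal colour are
          non-adjacent, hence orthogonal.\<close>
        then show "M u w = 0" using c(2)[of _ u _ w] orth by blast
      qed (use c(1) unit in auto)
    qed simp_all
  qed
  obtain x where x: "x \<in> carrier_vec n" "x \<noteq> 0\<^sub>v n" "gram_mat n f *\<^sub>v x = \<mu> \<cdot>\<^sub>v x"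
    using ev unfolding eigenvalue_def eigenvector_def by (auto simp: gram_mat_def)
  have eigen: "app (\<lambda>u. x $ u) u = \<mu> * x $ u" if "u < n" for u
  proof -
    have "app (\<lambda>u. x $ u) u = (gram_mat n f *\<^sub>v x) $ u"
      using that x(1) by (simp add: app_def gram_mat_def scalar_prod_def[of _ x] atLeast0LessThan M)
    then show ?thesis using x that by simp
  qed
  have nz: "\<exists>u<n. x $ u \<noteq> 0"
  proof (rule ccontr)
    assume "\<not> ?thesis"
    then have "x = 0\<^sub>v n" using x(1) by (intro eq_vecI) auto
    with x(2) show False by simp
  qed
  have "\<mu> ^ (2 * t + 1) \<le> real n * real (4 * t) ^ (2 * t + 1)"
    by (rule eigenvalue_power_le[OF form eigen nz True])
  also have "\<dots> = (4 * real t * real n powr (1 / real (2 * t + 1))) ^ (2 * t + 1)"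
  proof -
    have "(real n powr (1 / real (2 * t + 1))) ^ (2 * t + 1) = real n"
      using nz by (subst powr_power) auto
    then show ?thesis by (simp add: power_mult_distrib)
  qed
  finally show ?thesis
    by (rule power_le_imp_le_base[where n = "2 * t", simplified Suc_eq_plus1]) simp
next
  case False
  then show ?thesis by (rule order_trans[OF leI]) simp
qed

theorem theorem1p3:
  shows "\<exists>C > 0 :: real. \<forall>n t :: nat. n \<ge> 1 \<longrightarrow> t \<ge> 1 \<longrightarrow>
    lambda_free n (cycle_graph (2 * t + 1)) \<le> C * real t * real n powr (1 / real (2 * t + 1))"
\<comment> \<open>The constant comes from the \<open>4 * t\<close> colours of a ball:
  \<open>2 * t\<close> per layer, doubled for the parity of the depth.\<close>
proof (intro exI[of _ 4] conjI allI impI)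
  fix n t :: nat
  assume n: "1 \<le> n" and t: "1 \<le> t"
  let ?b = "4 * real t * real n powr (1 / real (2 * t + 1))"
  have "theta_bar G \<le> ?b"
    if G: "pair_graph G" "pverts G = {..<n}" "H_free (cycle_graph (2 * t + 1)) G" for G
    unfolding theta_bar_def
  proof (rule cSup_least[OF theta_bar_nonempty[OF G(2)]])
    fix y assume "y \<in> {largest_eigenvalue (gram_mat (card (pverts G)) f) |d f. orthonormal_rep G d f}"
    then obtain d f where y: "y = largest_eigenvalue (gram_mat n f)" and f: "orthonormal_rep G d f"
      using G(2) by auto
    have "eigenvalue (gram_mat n f) y"
      using largest_eigenvalue_in_spectrum[OF G(1,2) _ f] n y by (simp add: spectrum_def)
    then show "y \<le> ?b" by (rule eigenvalue_gram_mat_cycle_free_le[OF G t f])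
  qed
  then show "lambda_free n (cycle_graph (2 * t + 1)) \<le> ?b"
    \<comment> \<open>From \<open>t\<close> one gets \<open>2 * t + 1 \<ge> 3\<close>, which makes
      the set under \<open>Max\<close> nonempty.\<close>
    unfolding lambda_free_def using lambda_free_finite lambda_free_cycle_nonempty[of "2 * t + 1" n] t
    by (subst Max_le_iff) auto
qed simp

end
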